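(* Let $v$ be a Hamiltonian flow (with no restriction on the number of singular points) on a (possibly non-compact) surface $S$. Then the $\omega$-limit set of any non-closed orbit of $v$ consists of singular points. In particular, $v$ has no non-closed recurrent points.
   Context: A surface is a paracompact two-dimensional manifold (possibly with boundary). A flow on $S$ is a continuous $\mathbb{R}$-action $v:\mathbb{R}\times S\to S$, $v_t:=v(t,\cdot)$. A point $x$ is singular if $v_t(x)=x$ for all $t$; it is periodic if there is $T>0$ with $v_T(x)=x$ and $v_t(x)\ne x$ for $0<t<T$. A point or orbit is closed if it is singular or periodic. The limit sets are $\omega(x)=\bigcap_{n\in\mathbb{R}}\overline{\{v_t(x)\mid t>n\}}$ and $\alpha(x)=\bigcap_{n\in\mathbb{R}}\overline{\{v_t(x)\mid t<n\}}$ (the $\omega$-limit set of an orbit is that of any of its points). A point $x$ is recurrent if $x\in\omega(x)\cup\alpha(x)$. A $C^r$ vector field $Y$ ($r\in\mathbb{Z}_{\ge 0}$) on an orientable surface $\Sigma$ is Hamiltonian if there is a $C^{r+1}$ function $H:\Sigma\to\mathbb{R}$ (the Hamiltonian) such that $dH=\omega(Y,\cdot)$ as a one-form, where here $\omega$ is a volume form of $\Sigma$. A flow is Hamiltonian if it is topologically equivalent (i.e. there is a homeomorphism taking orbits onto orbits and preserving their direction) to a flow generated by a Hamiltonian vector field. *)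

theory Defs
  imports "HOL-Analysis.Analysis" "HOL-Library.Extended_Nat"
begin

section \<open>Surfaces\<close>

definition half_plane :: "(real ^ 2) set"
  where "half_plane = {x. 0 \<le> x $ 2}"

definition paracompact_space :: "'a topology \<Rightarrow> bool"
  where "paracompact_space X \<longleftrightarrow>
    (\<forall>\<U>. (\<forall>U\<in>\<U>. openin X U) \<and> \<Union>\<U> = topspace X \<longrightarrow>
      (\<exists>\<V>. (\<forall>V\<in>\<V>. openin X V \<and> (\<exists>U\<in>\<U>. V \<subseteq> U)) \<and> \<Union>\<V> = topspace X
           \<and> locally_finite_in X \<V>))"

text \<open>A chart is a pair of its domain and its coordinate map. It takes values in the closed
  half-plane, so that the charts cover interior and boundary points alike.\<close>

type_synonym 'a chart = "'a set \<times> ('a \<Rightarrow> real ^ 2)"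

definition chart_dom :: "'a chart \<Rightarrow> 'a set"
  where "chart_dom c = fst c"

definition coord :: "'a chart \<Rightarrow> 'a \<Rightarrow> real ^ 2"
  where "coord c = snd c"

definition chart_img :: "'a chart \<Rightarrow> (real ^ 2) set"
  where "chart_img c = coord c ` chart_dom c"

definition param :: "'a chart \<Rightarrow> real ^ 2 \<Rightarrow> 'a"
  where "param c = inv_into (chart_dom c) (coord c)"

definition chart :: "'a topology \<Rightarrow> 'a chart \<Rightarrow> bool"
  where "chart X c \<longleftrightarrow>
    openin X (chart_dom c) \<and>
    openin (top_of_set half_plane) (chart_img c) \<and>
    homeomorphic_map (subtopology X (chart_dom c)) (top_of_set (chart_img c)) (coord c)"

definition surface :: "'a topology \<Rightarrow> bool"
  where "surface X \<longleftrightarrow>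
    Hausdorff_space X \<and> paracompact_space X \<and>
    (\<forall>p\<in>topspace X. \<exists>c. chart X c \<and> p \<in> chart_dom c)"


section \<open>Flows\<close>

definition flow :: "'a topology \<Rightarrow> (real \<Rightarrow> 'a \<Rightarrow> 'a) \<Rightarrow> bool"
  where "flow X v \<longleftrightarrow>
    continuous_map (prod_topology euclideanreal X) X (\<lambda>(t, x). v t x) \<and>
    (\<forall>x\<in>topspace X. v 0 x = x \<and> (\<forall>s t. v (s + t) x = v s (v t x)))"

definition orbit :: "(real \<Rightarrow> 'a \<Rightarrow> 'a) \<Rightarrow> 'a \<Rightarrow> 'a set"
  where "orbit v x = range (\<lambda>t. v t x)"

definition singular_point :: "(real \<Rightarrow> 'a \<Rightarrow> 'a) \<Rightarrow> 'a \<Rightarrow> bool"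
  where "singular_point v x \<longleftrightarrow> (\<forall>t. v t x = x)"

definition periodic_point :: "(real \<Rightarrow> 'a \<Rightarrow> 'a) \<Rightarrow> 'a \<Rightarrow> bool"
  where "periodic_point v x \<longleftrightarrow>
    (\<exists>T>0. v T x = x \<and> (\<forall>t. 0 < t \<and> t < T \<longrightarrow> v t x \<noteq> x))"

definition closed_point :: "(real \<Rightarrow> 'a \<Rightarrow> 'a) \<Rightarrow> 'a \<Rightarrow> bool"
  where "closed_point v x \<longleftrightarrow> singular_point v x \<or> periodic_point v x"

definition omega_limit :: "'a topology \<Rightarrow> (real \<Rightarrow> 'a \<Rightarrow> 'a) \<Rightarrow> 'a \<Rightarrow> 'a set"
  where "omega_limit X v x = (\<Inter>n. X closure_of {v t x |t. t > n})"

definition alpha_limit :: "'a topology \<Rightarrow> (real \<Rightarrow> 'a \<Rightarrow> 'a) \<Rightarrow> 'a \<Rightarrow> 'a set"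
  where "alpha_limit X v x = (\<Inter>n. X closure_of {v t x |t. t < n})"

definition recurrent_point :: "'a topology \<Rightarrow> (real \<Rightarrow> 'a \<Rightarrow> 'a) \<Rightarrow> 'a \<Rightarrow> bool"
  where "recurrent_point X v x \<longleftrightarrow> x \<in> omega_limit X v x \<union> alpha_limit X v x"

text \<open>That the homeomorphism preserves the direction of an orbit is expressed by an increasing
  reparametrization of time along that orbit (for a periodic orbit, a lift of the circle map to
  the line). Monotonicity alone would not do there: a time change that jumps by multiples of the
  period can be increasing and yet reverse the direction, so it has to be a homeomorphism.\<close>

definition topologically_equivalent ::
    "'a topology \<Rightarrow> (real \<Rightarrow> 'a \<Rightarrow> 'a) \<Rightarrow> 'b topology \<Rightarrow> (real \<Rightarrow> 'b \<Rightarrow> 'b) \<Rightarrow> bool"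
  where "topologically_equivalent X v Y w \<longleftrightarrow>
    (\<exists>h. homeomorphic_map X Y h \<and>
      (\<forall>x\<in>topspace X. h ` orbit v x = orbit w (h x) \<and>
        (\<exists>\<tau>. homeomorphic_map euclideanreal euclideanreal \<tau> \<and> strict_mono \<tau> \<and>
             (\<forall>t. h (v t x) = w (\<tau> t) (h x)))))"


section \<open>Differentiable functions on subsets of the plane\<close>

text \<open>Functions of class \<open>C\<^sup>k\<close> on an open set.\<close>

primrec Ck_open ::
    "nat \<Rightarrow> ('a::real_normed_vector \<Rightarrow> 'b::real_normed_vector) \<Rightarrow> 'a set \<Rightarrow> bool"
  where
    "Ck_open 0 f W \<longleftrightarrow> continuous_on W f"
  | "Ck_open (Suc k) f W \<longleftrightarrow> (\<forall>x\<in>W. f differentiable at x) \<and>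
       (\<forall>u. Ck_open k (\<lambda>x. frechet_derivative f (at x) u) W)"

text \<open>On an arbitrary set, such as a relatively open subset of the half-plane, a function is of
  class \<open>C\<^sup>r\<close> (with \<open>r = \<infinity>\<close> allowed) if it extends to such a function near each point.\<close>

definition Cr_on ::
    "enat \<Rightarrow> ('a::real_normed_vector \<Rightarrow> 'b::real_normed_vector) \<Rightarrow> 'a set \<Rightarrow> bool"
  where "Cr_on r f A \<longleftrightarrow>
    (\<forall>x\<in>A. \<exists>W g. open W \<and> x \<in> W \<and> (\<forall>k. enat k \<le> r \<longrightarrow> Ck_open k g W) \<and>
      (\<forall>y\<in>A \<inter> W. g y = f y))"


section \<open>Smooth structures, vector fields and volume forms\<close>

definition transition :: "'a chart \<Rightarrow> 'a chart \<Rightarrow> real ^ 2 \<Rightarrow> real ^ 2"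
  where "transition c d = coord d \<circ> param c"

text \<open>The derivative at \<open>p\<close> of the change of coordinates from \<open>c\<close> to \<open>d\<close>; relatively open
  subsets of the half-plane determine it uniquely, at boundary points as well.\<close>

definition transition_deriv :: "'a chart \<Rightarrow> 'a chart \<Rightarrow> 'a \<Rightarrow> real ^ 2 \<Rightarrow> real ^ 2"
  where "transition_deriv c d p =
    frechet_derivative (transition c d)
      (at (coord c p) within coord c ` (chart_dom c \<inter> chart_dom d))"

definition smooth_atlas :: "'a topology \<Rightarrow> 'a chart set \<Rightarrow> bool"
  where "smooth_atlas X \<A> \<longleftrightarrow>
    (\<forall>c\<in>\<A>. chart X c) \<and> (\<Union>c\<in>\<A>. chart_dom c) = topspace X \<and>
    (\<forall>c\<in>\<A>. \<forall>d\<in>\<A>. Cr_on \<infinity> (transition c d) (coord c ` (chart_dom c \<inter> chart_dom d)))"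

text \<open>The atlas need not be maximal, so an oriented atlas is sought among the charts that are
  compatible with it.\<close>

definition orientable :: "'a topology \<Rightarrow> 'a chart set \<Rightarrow> bool"
  where "orientable X \<A> \<longleftrightarrow>
    (\<exists>\<B>. smooth_atlas X \<B> \<and> smooth_atlas X (\<A> \<union> \<B>) \<and>
      (\<forall>c\<in>\<B>. \<forall>d\<in>\<B>. \<forall>p\<in>chart_dom c \<inter> chart_dom d.
        det (matrix (transition_deriv c d p)) > 0))"

definition Cr_function :: "enat \<Rightarrow> 'a chart set \<Rightarrow> ('a \<Rightarrow> real) \<Rightarrow> bool"
  where "Cr_function r \<A> H \<longleftrightarrow> (\<forall>c\<in>\<A>. Cr_on r (H \<circ> param c) (chart_img c))"

text \<open>Vector fields and 2-forms are given by their local representations in the charts of the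
  atlas, related by the derivatives of the changes of coordinates: \<open>Y c p\<close> is the coordinate
  vector of \<open>Y\<close> at \<open>p\<close> in the chart \<open>c\<close>, and \<open>\<Omega> c p\<close> is the form at \<open>p\<close> acting on coordinate
  vectors.\<close>

definition Cr_vector_field ::
    "enat \<Rightarrow> 'a chart set \<Rightarrow> ('a chart \<Rightarrow> 'a \<Rightarrow> real ^ 2) \<Rightarrow> bool"
  where "Cr_vector_field r \<A> Y \<longleftrightarrow>
    (\<forall>c\<in>\<A>. Cr_on r (Y c \<circ> param c) (chart_img c)) \<and>
    (\<forall>c\<in>\<A>. \<forall>d\<in>\<A>. \<forall>p\<in>chart_dom c \<inter> chart_dom d.
      Y d p = transition_deriv c d p (Y c p))"

definition volume_form ::
    "'a chart set \<Rightarrow> ('a chart \<Rightarrow> 'a \<Rightarrow> real ^ 2 \<Rightarrow> real ^ 2 \<Rightarrow> real) \<Rightarrow> bool"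
  where "volume_form \<A> \<Omega> \<longleftrightarrow>
    (\<forall>c\<in>\<A>. \<forall>p\<in>chart_dom c.
      bilinear (\<Omega> c p) \<and> (\<forall>u. \<Omega> c p u u = 0) \<and> (\<exists>u w. \<Omega> c p u w \<noteq> 0)) \<and>
    (\<forall>c\<in>\<A>. \<forall>u w. Cr_on \<infinity> (\<lambda>x. \<Omega> c (param c x) u w) (chart_img c)) \<and>
    (\<forall>c\<in>\<A>. \<forall>d\<in>\<A>. \<forall>p\<in>chart_dom c \<inter> chart_dom d. \<forall>u w.
      \<Omega> c p u w = \<Omega> d p (transition_deriv c d p u) (transition_deriv c d p w))"


section \<open>Hamiltonian flows\<close>

text \<open>The derivative condition is the equation \<open>dH = \<omega>(Y, \<cdot>)\<close> of one-forms, read in each chart.\<close>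

definition hamiltonian_vector_field ::
    "nat \<Rightarrow> 'a chart set \<Rightarrow> ('a chart \<Rightarrow> 'a \<Rightarrow> real ^ 2) \<Rightarrow> bool"
  where "hamiltonian_vector_field r \<A> Y \<longleftrightarrow>
    Cr_vector_field (enat r) \<A> Y \<and>
    (\<exists>\<Omega> H. volume_form \<A> \<Omega> \<and> Cr_function (enat (r + 1)) \<A> H \<and>
      (\<forall>c\<in>\<A>. \<forall>p\<in>chart_dom c.
        ((H \<circ> param c) has_derivative \<Omega> c p (Y c p)) (at (coord c p) within chart_img c)))"

definition generates ::
    "'a topology \<Rightarrow> 'a chart set \<Rightarrow> ('a chart \<Rightarrow> 'a \<Rightarrow> real ^ 2) \<Rightarrow> (real \<Rightarrow> 'a \<Rightarrow> 'a) \<Rightarrow> bool"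
  where "generates X \<A> Y w \<longleftrightarrow>
    (\<forall>p\<in>topspace X. \<forall>t. \<forall>c\<in>\<A>. w t p \<in> chart_dom c \<longrightarrow>
      ((\<lambda>s. coord c (w s p)) has_vector_derivative Y c (w t p)) (at t))"

text \<open>The surface that carries the Hamiltonian vector field has its points in a type \<open>'b\<close> of its
  own. HOL cannot quantify over that type here; as it is left free in a theorem that assumes
  this predicate, the theorem covers all of them.\<close>

definition hamiltonian_flow ::
    "'b itself \<Rightarrow> 'a topology \<Rightarrow> (real \<Rightarrow> 'a \<Rightarrow> 'a) \<Rightarrow> bool"
  where "hamiltonian_flow (_ :: 'b itself) S v \<longleftrightarrow>
    flow S v \<and>
    (\<exists>(\<Sigma> :: 'b topology) \<A> r Y w.
      surface \<Sigma> \<and> smooth_atlas \<Sigma> \<A> \<and> orientable \<Sigma> \<A> \<and>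
      hamiltonian_vector_field r \<A> Y \<and>
      flow \<Sigma> w \<and> generates \<Sigma> \<A> Y w \<and>
      topologically_equivalent S v \<Sigma> w)"

end

theory Submission
  imports Defs
begin

text \<open>Let \<open>w\<close> be the flow generated by a Hamiltonian vector field \<open>Y\<close> with Hamiltonian \<open>H\<close>. As
  \<open>dH(Y) = \<omega>(Y, Y) = 0\<close>, the function \<open>H\<close> is constant on every orbit, and by continuity it has the
  same value on the limit sets of the orbit.

  Suppose that \<open>Y\<close> does not vanish at a point \<open>z\<close>. Near \<open>z\<close> the level set of \<open>H\<close> through \<open>z\<close> is just
  a short piece of the orbit of \<open>z\<close> (\<open>level_set_is_local_orbit\<close>). Indeed, work in a chart and let \<open>n\<close>
  be orthogonal to \<open>Y(z)\<close>. The orbit leaves \<open>z\<close> with velocity \<open>Y(z)\<close>, so it meets every line in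
  direction \<open>n\<close> that passes close to \<open>z\<close>. On such a line \<open>H\<close> is injective near \<open>z\<close>, since
  \<open>dH(n) = \<omega>(Y, n)\<close> is continuous and nonzero at \<open>z\<close>. So a point at the level of \<open>z\<close> coincides with
  the point of the orbit on its line. This argument replaces the implicit function theorem and needs
  only that small neighbourhoods of \<open>z\<close> in the half-plane are convex; interior and boundary points
  of the surface are thus treated alike.

  Now suppose that a limit set of the orbit of \<open>x\<close> contains a nonsingular point \<open>y\<close>. The field \<open>Y\<close>
  may vanish at \<open>y\<close> if it is merely continuous, but it cannot vanish on the whole orbit of \<open>y\<close>
  (\<open>field_nonzero_on_orbit\<close>), and limit sets are invariant, so some \<open>z\<close> on this orbit lies in the
  limit set and has \<open>Y(z) \<noteq> 0\<close>. The orbit of \<open>x\<close> stays in the level set of \<open>z\<close> and enters every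
  neighbourhood of \<open>z\<close> at arbitrarily large times, hence it meets the short orbit piece of \<open>z\<close> at two
  times that differ by more than the length of the piece. This gives a nonzero period, so \<open>x\<close> is
  closed (\<open>closed_if_nonsingular_limit_point\<close>).

  The argument is insensitive to the direction of time. It is carried out for the set of limit points
  for \<open>\<bar>t\<bar> \<rightarrow> \<infinity>\<close>, which contains both limit sets. This covers recurrence in either direction at once,
  and the statement passes through a topological equivalence, which respects closed points,
  singular points and these limit sets.\<close>

section \<open>Level sets in the plane\<close>

lemma orthogonal_complement_plane:
  fixes u d :: "real ^ 2"
  assumes "u \<noteq> 0" "d \<bullet> u = 0"
  shows "\<exists>k. d = k *\<^sub>R vector [- (u $ 2), u $ 1]"
proof -
  have pos: "u $ 1 * u $ 1 + u $ 2 * u $ 2 \<noteq> 0"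
    using assms(1) by (auto simp: vec_eq_iff forall_2 sum_squares_eq_zero_iff)
  have orth: "d $ 1 * u $ 1 + d $ 2 * u $ 2 = 0"
    using assms(2) by (simp add: inner_vec_def sum_2)
  define N where "N = u $ 1 * u $ 1 + u $ 2 * u $ 2"
  have 1: "d $ 1 * N = - (d $ 2 * u $ 1 - d $ 1 * u $ 2) * u $ 2"
    and 2: "d $ 2 * N = (d $ 2 * u $ 1 - d $ 1 * u $ 2) * u $ 1"
    using orth unfolding N_def by algebra+
  have "d = ((d $ 2 * u $ 1 - d $ 1 * u $ 2) / N) *\<^sub>R vector [- (u $ 2), u $ 1]"
    using 1 2 pos unfolding N_def[symmetric]
    by (simp add: vec_eq_iff forall_2 field_simps)
  then show ?thesis by blast
qed

lemma alternating_bilinear_plane: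
  fixes f :: "real ^ 2 \<Rightarrow> real ^ 2 \<Rightarrow> real"
  assumes f: "bilinear f" and alt: "\<And>a. f a a = 0"
  shows "f a b = (a $ 1 * b $ 2 - a $ 2 * b $ 1) * f (axis 1 1) (axis 2 1)"
proof -
  define e1 e2 :: "real ^ 2" where "e1 = axis 1 1" and "e2 = axis 2 1"
  have basis: "x = x $ 1 *\<^sub>R e1 + x $ 2 *\<^sub>R e2" for x
    by (simp add: vec_eq_iff forall_2 axis_def e1_def e2_def)
  have sums: "f (p *\<^sub>R e1 + q *\<^sub>R e2) (p' *\<^sub>R e1 + q' *\<^sub>R e2) = p * q' * f e1 e2 + q * p' * f e2 e1"
    for p q p' q'
    using f by (simp add: bilinear_ladd bilinear_radd bilinear_lmul bilinear_rmul alt algebra_simps)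
  have "f e2 e1 = - f e1 e2"
    using sums[of 1 1 1 1] alt[of "1 *\<^sub>R e1 + 1 *\<^sub>R e2"] by linarith
  then have "f a b = (a $ 1 * b $ 2 - a $ 2 * b $ 1) * f e1 e2"
    using sums[of "a $ 1" "a $ 2" "b $ 1" "b $ 2"] basis[of a] basis[of b]
    by (simp add: algebra_simps)
  then show ?thesis by (simp add: e1_def e2_def)
qed

text \<open>Along a segment in direction \<open>n\<close> the derivative of \<open>F\<close> is a nonzero multiple of \<open>D q n\<close>, so
  Rolle's theorem forbids equal values at the two ends. The derivative is only taken within \<open>A\<close>,
  which allows segments that touch or run along the boundary of the half-plane.\<close>

lemma injective_on_transversal:
  fixes F :: "'v::real_normed_vector \<Rightarrow> real"
  assumes "convex C" "C \<subseteq> A"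
    and der: "\<And>q. q \<in> C \<Longrightarrow> (F has_derivative D q) (at q within A)"
    and nz: "\<And>q. q \<in> C \<Longrightarrow> D q n \<noteq> 0"
    and ab: "a \<in> C" "b \<in> C" "b - a = k *\<^sub>R n" "F a = F b"
  shows "a = b"
proof (rule ccontr)
  assume "a \<noteq> b"
  then have k: "k \<noteq> 0" using ab(3) by auto
  define l where "l = (\<lambda>\<sigma>. a + \<sigma> *\<^sub>R (k *\<^sub>R n))"
  have lC: "l \<sigma> \<in> C" if "\<sigma> \<in> {0..1}" for \<sigma>
  proof -
    have "l \<sigma> = (1 - \<sigma>) *\<^sub>R a + \<sigma> *\<^sub>R b"
      unfolding l_def ab(3)[symmetric] by (simp add: algebra_simps)
    then show ?thesis using convexD_alt[OF assms(1) ab(1,2)] that by auto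
  qed
  have dl: "((\<lambda>\<sigma>. F (l \<sigma>)) has_derivative (\<lambda>\<sigma>. D (l \<rho>) (\<sigma> *\<^sub>R (k *\<^sub>R n)))) (at \<rho> within {0..1})"
    if "\<rho> \<in> {0..1}" for \<rho>
  proof (rule has_derivative_in_compose2[where t = C and g = F and g' = D])
    show "(F has_derivative D x) (at x within C)" if "x \<in> C" for x
      using has_derivative_subset[OF der[OF that] assms(2)] .
    show "l ` {0..1} \<subseteq> C" using lC by auto
    show "(l has_derivative (\<lambda>\<sigma>. \<sigma> *\<^sub>R (k *\<^sub>R n))) (at \<rho> within {0..1})"
      unfolding l_def by (auto intro!: derivative_eq_intros)
  qed (use that in auto)
  obtain \<rho> where \<rho>: "\<rho> \<in> {0<..<1}"
    and eq: "F (l 1) - F (l 0) = D (l \<rho>) ((1 - 0) *\<^sub>R (k *\<^sub>R n))"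
    using mvt_simple[of 0 1 "\<lambda>\<sigma>. F (l \<sigma>)", OF _ dl] by auto
  have "F (l 1) - F (l 0) = 0" using ab(3,4) unfolding l_def by (simp add: algebra_simps flip: ab(3))
  moreover have \<rho>C: "l \<rho> \<in> C" using lC \<rho> by auto
  moreover have "linear (D (l \<rho>))" using der[OF \<rho>C] has_derivative_linear by blast
  ultimately have "k * D (l \<rho>) n = 0" using eq by (simp add: linear_scale)
  then show False using nz[OF \<rho>C] k by simp
qed

text \<open>The plane core of the argument: by the intermediate value theorem the component of \<open>\<gamma>\<close> along
  its initial velocity \<open>u\<close> takes all values near its initial one, so for every point \<open>z\<close> near \<open>\<gamma> 0\<close>
  some \<open>\<gamma> s\<close> differs from \<open>z\<close> by a vector orthogonal to \<open>u\<close>. In that direction \<open>F\<close> is injective.\<close>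

lemma level_set_covered_by_curve:
  fixes F :: "real ^ 2 \<Rightarrow> real" and \<gamma> :: "real \<Rightarrow> real ^ 2"
  assumes K: "convex K" "openin (top_of_set K) A"
    and der: "\<And>q. q \<in> A \<Longrightarrow> (F has_derivative D q) (at q within A)"
    and cont: "continuous_on A (\<lambda>q. D q (vector [- (u $ 2), u $ 1]))"
    and nz: "D (\<gamma> 0) (vector [- (u $ 2), u $ 1]) \<noteq> 0"
    and u: "u \<noteq> 0" "(\<gamma> has_vector_derivative u) (at 0)"
    and \<delta>: "\<delta> > 0" "continuous_on {-\<delta><..<\<delta>} \<gamma>"
    and \<gamma>A: "\<And>s. \<bar>s\<bar> < \<delta> \<Longrightarrow> \<gamma> s \<in> A" "\<And>s. \<bar>s\<bar> < \<delta> \<Longrightarrow> F (\<gamma> s) = F (\<gamma> 0)"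
  obtains \<epsilon> where "\<epsilon> > 0"
    "\<And>z. z \<in> A \<Longrightarrow> dist z (\<gamma> 0) < \<epsilon> \<Longrightarrow> F z = F (\<gamma> 0) \<Longrightarrow> \<exists>s. \<bar>s\<bar> < \<delta> \<and> z = \<gamma> s"
proof -
  define n :: "real ^ 2" where "n = vector [- (u $ 2), u $ 1]"
  define q where "q = \<gamma> 0"
  have qA: "q \<in> A" unfolding q_def using \<gamma>A \<delta> by auto
  obtain e1 where e1: "e1 > 0" "ball q e1 \<inter> K \<subseteq> A"
    using K(2) qA unfolding openin_contains_ball by blast
  have AK: "A \<subseteq> K" using K(2) openin_imp_subset by blast
  obtain e2 where e2: "e2 > 0" "\<And>z. z \<in> A \<Longrightarrow> dist z q < e2 \<Longrightarrow> D z n \<noteq> 0"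
  proof -
    have "\<exists>d>0. \<forall>z\<in>A. dist z q < d \<longrightarrow> dist (D z n) (D q n) < \<bar>D q n\<bar>"
      using cont qA nz unfolding continuous_on_iff n_def[symmetric] q_def[symmetric] by simp
    then obtain d where "d > 0" "\<forall>z\<in>A. dist z q < d \<longrightarrow> dist (D z n) (D q n) < \<bar>D q n\<bar>" by blast
    then show ?thesis using that[of d] by (metis dist_real_def diff_0 abs_minus less_irrefl)
  qed
  define e where "e = min e1 e2"
  define C where "C = ball q e \<inter> K"
  have e: "e > 0" using e1 e2 by (simp add: e_def)
  have C: "convex C" "C \<subseteq> A"
    using e1 K(1) unfolding C_def e_def by (auto intro!: convex_Int)
  have CD: "D z n \<noteq> 0" if "z \<in> C" for z
    using e2(2)[of z] C(2) that by (auto simp: C_def e_def dist_commute)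
  \<comment> \<open>On a time interval \<open>[-r, r]\<close> the curve stays in \<open>C\<close>, and its component \<open>g\<close> along \<open>u\<close> has
    opposite signs at the two ends.\<close>
  have "isCont \<gamma> 0" using u(2) has_vector_derivative_continuous by blast
  then obtain d1 where d1: "d1 > 0" "\<And>s. \<bar>s\<bar> < d1 \<Longrightarrow> dist (\<gamma> s) q < e"
    using e unfolding continuous_at_eps_delta q_def by (auto simp: dist_real_def)
  define g where "g = (\<lambda>s. (\<gamma> s - q) \<bullet> u)"
  have dg: "(g has_real_derivative u \<bullet> u) (at 0)"
  proof -
    have "(\<gamma> has_derivative (\<lambda>h. h *\<^sub>R u)) (at 0)"
      using u(2) unfolding has_vector_derivative_def .
    then have "(g has_derivative (\<lambda>h. (h *\<^sub>R u) \<bullet> u)) (at 0)"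
      unfolding g_def by (auto intro!: derivative_eq_intros)
    then show ?thesis unfolding has_field_derivative_def by (simp add: mult_commute_abs)
  qed
  have uu: "u \<bullet> u > 0" using u(1) by simp
  have g0: "g 0 = 0" by (simp add: g_def q_def)
  obtain r1 where r1: "r1 > 0" "\<And>h. h > 0 \<Longrightarrow> h < r1 \<Longrightarrow> 0 < g h"
    using DERIV_pos_inc_right[OF dg uu] g0 by auto
  obtain r2 where r2: "r2 > 0" "\<And>h. h > 0 \<Longrightarrow> h < r2 \<Longrightarrow> g (- h) < 0"
    using DERIV_pos_inc_left[OF dg uu] g0 by auto
  define r where "r = min (min r1 r2) (min d1 \<delta>) / 2"
  have r: "r > 0" "r < r1" "r < r2" "r < d1" "r < \<delta>"
    using r1(1) r2(1) d1(1) \<delta>(1) unfolding r_def by auto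
  have gr: "g r > 0" "g (- r) < 0" using r1(2) r2(2) r by auto
  define \<epsilon> where "\<epsilon> = min e (min (g r) (- g (- r)) / norm u)"
  have \<epsilon>: "\<epsilon> > 0" using e gr u(1) by (simp add: \<epsilon>_def)
  show thesis
  proof (rule that[OF \<epsilon>])
    fix z assume z: "z \<in> A" "dist z (\<gamma> 0) < \<epsilon>" "F z = F (\<gamma> 0)"
    have "\<bar>(z - q) \<bullet> u\<bar> \<le> norm (z - q) * norm u" by (rule Cauchy_Schwarz_ineq2)
    also have "\<dots> \<le> \<epsilon> * norm u"
      using z(2) unfolding q_def dist_norm by (intro mult_right_mono) auto
    also have "\<dots> \<le> (min (g r) (- g (- r)) / norm u) * norm u"
      unfolding \<epsilon>_def by (intro mult_right_mono) auto
    also have "\<dots> = min (g r) (- g (- r))" using u(1) by simp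
    finally have bounds: "g (- r) \<le> (z - q) \<bullet> u" "(z - q) \<bullet> u \<le> g r" by auto
    have "continuous_on {- r..r} g"
      unfolding g_def using r
      by (intro continuous_intros continuous_on_subset[OF \<delta>(2)]) auto
    then obtain s where s: "- r \<le> s" "s \<le> r" "g s = (z - q) \<bullet> u"
      using IVT'[of g "- r" "(z - q) \<bullet> u" r] bounds r(1) by auto
    have s': "\<bar>s\<bar> < \<delta>" "\<bar>s\<bar> < d1" using s r by auto
    have "(z - \<gamma> s) \<bullet> u = 0" using s(3) unfolding g_def by (simp add: inner_diff_left)
    then obtain k where k: "z - \<gamma> s = k *\<^sub>R n"
      using orthogonal_complement_plane[OF u(1)] unfolding n_def by blast
    have "\<gamma> s = z"
    proof (rule injective_on_transversal[OF C(1,2)])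
      show "\<gamma> s \<in> C" using d1(2)[OF s'(2)] \<gamma>A(1)[OF s'(1)] AK
        by (auto simp: C_def dist_commute)
      show "z \<in> C" using z AK by (auto simp: C_def \<epsilon>_def q_def dist_commute)
      show "F (\<gamma> s) = F z" using \<gamma>A(2)[OF s'(1)] z(3) by (rule trans[OF _ sym])
    qed (use C CD der k in auto)
    then show "\<exists>s. \<bar>s\<bar> < \<delta> \<and> z = \<gamma> s" using s' by blast
  qed
qed

section \<open>Flows and their limit sets\<close>

lemma flow_continuous_orbit:
  assumes "flow X v" "x \<in> topspace X"
  shows "continuous_map euclideanreal X (\<lambda>t. v t x)"
proof -
  have "continuous_map euclideanreal (prod_topology euclideanreal X) (\<lambda>t. (t, x))"
    using assms(2) by (auto intro: continuous_intros)
  moreover have "continuous_map (prod_topology euclideanreal X) X (\<lambda>(t, x). v t x)"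
    using assms(1) unfolding flow_def by blast
  ultimately have "continuous_map euclideanreal X ((\<lambda>(t, x). v t x) \<circ> (\<lambda>t. (t, x)))"
    by (rule continuous_map_compose)
  then show ?thesis by (simp add: o_def)
qed

lemma flow_continuous_time_map:
  assumes "flow X v"
  shows "continuous_map X X (v t)"
proof -
  have "continuous_map X (prod_topology euclideanreal X) (\<lambda>x. (t, x))"
    by (auto intro: continuous_intros)
  moreover have "continuous_map (prod_topology euclideanreal X) X (\<lambda>(t, x). v t x)"
    using assms(1) unfolding flow_def by blast
  ultimately have "continuous_map X X ((\<lambda>(t, x). v t x) \<circ> (\<lambda>x. (t, x)))"
    by (rule continuous_map_compose)
  then show ?thesis by (simp add: o_def)
qed

lemma flow_in_space: "flow X v \<Longrightarrow> x \<in> topspace X \<Longrightarrow> v t x \<in> topspace X"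
  using flow_continuous_time_map[of X v t] by (auto simp: continuous_map_def)

lemma flow_add: "flow X v \<Longrightarrow> x \<in> topspace X \<Longrightarrow> v (s + t) x = v s (v t x)"
  and flow_0: "flow X v \<Longrightarrow> x \<in> topspace X \<Longrightarrow> v 0 x = x"
  unfolding flow_def by auto

lemma flow_period_iff:
  assumes "flow X v" "x \<in> topspace X"
  shows "v s x = v t x \<longleftrightarrow> v (s - t) x = x"
proof
  assume "v s x = v t x"
  then have "v (- t) (v s x) = v (- t) (v t x)" by simp
  then show "v (s - t) x = x"
    using flow_add[OF assms, of "- t" s] flow_add[OF assms, of "- t" t] flow_0[OF assms] by simp
next
  assume "v (s - t) x = x"
  then show "v s x = v t x" using flow_add[OF assms, of t "s - t"] by simp
qed

lemma flow_period_multiple: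
  assumes "flow X v" "x \<in> topspace X" "v s x = x"
  shows "v (of_nat n * s) x = x"
proof (induction n)
  case (Suc n)
  have "v (s + of_nat n * s) x = x"
    using flow_add[OF assms(1,2), of s "of_nat n * s"] Suc assms(3) by simp
  then show ?case by (simp add: algebra_simps)
qed (use flow_0[OF assms(1,2)] in simp)

text \<open>An arbitrary time is a multiple of a small one.\<close>

lemma singular_if_locally_fixed:
  assumes "flow X v" "x \<in> topspace X" "\<delta> > 0" "\<And>s. \<bar>s\<bar> < \<delta> \<Longrightarrow> v s x = x"
  shows "singular_point v x"
  unfolding singular_point_def
proof
  fix t
  obtain N :: nat where N: "\<bar>t\<bar> / \<delta> < real N" using reals_Archimedean2 by blast
  then have Npos: "real N > 0" using assms(3) by (smt (verit) divide_nonneg_pos)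
  have "\<bar>t / real N\<bar> < \<delta>" using N Npos assms(3) by (simp add: field_simps)
  then have "v (real N * (t / real N)) x = x"
    using flow_period_multiple[OF assms(1,2)] assms(4) by blast
  then show "v t x = x" using Npos by simp
qed

text \<open>The periods form a closed subgroup of the line. If it is not the whole line, its complement
  contains an interval, so it has no positive elements below the length of that interval, and a
  least positive period exists by compactness.\<close>

lemma closed_point_if_period:
  assumes "flow X v" "Hausdorff_space X" "x \<in> topspace X" "v T x = x" "T \<noteq> 0"
  shows "closed_point v x"
proof (cases "singular_point v x")
  case False
  then obtain t0 where t0: "v t0 x \<noteq> x" unfolding singular_point_def by blast
  have cl: "closed {t. v t x = x}"
  proof -
    have "closedin X {x}" using assms(2,3) by (simp add: closedin_Hausdorff_sing_eq)
    from closedin_continuous_map_preimage[OF flow_continuous_orbit[OF assms(1,3)] this]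
    show ?thesis by simp
  qed
  then have "open (- {t. v t x = x})" by auto
  then obtain \<delta> where \<delta>: "\<delta> > 0" "\<And>t. \<bar>t - t0\<bar> < \<delta> \<Longrightarrow> v t x \<noteq> x"
    using t0 unfolding open_dist dist_real_def by blast
  have big: "s \<ge> \<delta>" if s: "s > 0" "v s x = x" for s
  proof (rule ccontr)
    assume "\<not> s \<ge> \<delta>"
    define k where "k = \<lfloor>t0 / s\<rfloor>"
    have "v (of_int k * s) x = x"
    proof (cases "k \<ge> 0")
      case True
      then show ?thesis using flow_period_multiple[OF assms(1,3) s(2), of "nat k"] by simp
    next
      case False
      have "v (- s) x = x"
        using flow_period_iff[OF assms(1,3), of 0 s] s(2) flow_0[OF assms(1,3)] by simp
      from flow_period_multiple[OF assms(1,3) this, of "nat (- k)"] False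
      show ?thesis by simp
    qed
    moreover have "\<bar>of_int k * s - t0\<bar> < \<delta>"
    proof -
      have "of_int k \<le> t0 / s" "t0 / s < of_int k + 1" unfolding k_def by linarith+
      then have "of_int k * s \<le> t0" "t0 < of_int k * s + s"
        using s(1) by (simp_all add: field_simps)
      then show ?thesis using \<open>\<not> s \<ge> \<delta>\<close> by linarith
    qed
    ultimately show False using \<delta>(2) by blast
  qed
  define P where "P = {t. v t x = x} \<inter> {\<delta>..\<bar>T\<bar>}"
  have T: "v \<bar>T\<bar> x = x"
    using flow_period_iff[OF assms(1,3), of 0 T] assms(4) flow_0[OF assms(1,3)]
    by (auto simp: abs_if)
  have "\<bar>T\<bar> \<in> P" using T big[of "\<bar>T\<bar>"] assms(5) unfolding P_def by auto
  moreover have "compact P" unfolding P_def using cl by (intro closed_Int_compact) auto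
  ultimately obtain p where p: "p \<in> P" "\<And>s. s \<in> P \<Longrightarrow> p \<le> s"
    using compact_attains_inf[of P] by blast
  have "periodic_point v x"
    unfolding periodic_point_def
  proof (intro exI[of _ p] conjI allI impI)
    show "p > 0" "v p x = x" using p(1) \<delta>(1) unfolding P_def by auto
    fix t assume t: "0 < t \<and> t < p"
    show "v t x \<noteq> x"
    proof
      assume "v t x = x"
      then have "t \<in> P" using big[of t] t p(1) unfolding P_def by auto
      then show False using p(2) t by force
    qed
  qed
  then show ?thesis unfolding closed_point_def by blast
qed (simp add: closed_point_def)

text \<open>The limit points for \<open>\<bar>t\<bar> \<rightarrow> \<infinity>\<close>; working with them avoids repeating each argument for the
  reversed time.\<close>

definition two_sided_limit :: "'a topology \<Rightarrow> (real \<Rightarrow> 'a \<Rightarrow> 'a) \<Rightarrow> 'a \<Rightarrow> 'a set"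
  where "two_sided_limit X v x = (\<Inter>n. X closure_of {v t x |t. \<bar>t\<bar> > n})"

lemma omega_alpha_subset_two_sided_limit:
  "omega_limit X v x \<union> alpha_limit X v x \<subseteq> two_sided_limit X v x"
proof -
  have "omega_limit X v x \<subseteq> X closure_of {v t x |t. \<bar>t\<bar> > n}" for n
  proof -
    have "{v t x |t. t > \<bar>n\<bar>} \<subseteq> {v t x |t. \<bar>t\<bar> > n}" by fastforce
    from closure_of_mono[OF this, of X] show ?thesis unfolding omega_limit_def by blast
  qed
  moreover have "alpha_limit X v x \<subseteq> X closure_of {v t x |t. \<bar>t\<bar> > n}" for n
  proof -
    have "{v t x |t. t < - \<bar>n\<bar>} \<subseteq> {v t x |t. \<bar>t\<bar> > n}" by fastforce
    from closure_of_mono[OF this, of X] show ?thesis unfolding alpha_limit_def by blast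
  qed
  ultimately show ?thesis unfolding two_sided_limit_def by blast
qed

lemma two_sided_limit_in_space: "two_sided_limit X v x \<subseteq> topspace X"
  unfolding two_sided_limit_def using closure_of_subset_topspace by fastforce

text \<open>A continuous map that sends late points of one orbit to late points of another one maps limit
  points to limit points. This is used for the time maps of a flow (which shows that limit sets are
  invariant) and for a topological equivalence.\<close>

lemma two_sided_limit_image:
  assumes f: "continuous_map X Y f"
    and proper: "\<And>n. \<exists>m. \<forall>t. \<bar>t\<bar> > m \<longrightarrow> (\<exists>s. \<bar>s\<bar> > n \<and> f (v t x) = w s z)"
    and y: "y \<in> two_sided_limit X v x"
  shows "f y \<in> two_sided_limit Y w z"
  unfolding two_sided_limit_def
proof
  fix n
  obtain m where m: "\<forall>t. \<bar>t\<bar> > m \<longrightarrow> (\<exists>s. \<bar>s\<bar> > n \<and> f (v t x) = w s z)"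
    using proper by blast
  have "f y \<in> f ` (X closure_of {v t x |t. \<bar>t\<bar> > m})"
    using y unfolding two_sided_limit_def by blast
  also have "\<dots> \<subseteq> Y closure_of (f ` {v t x |t. \<bar>t\<bar> > m})"
    using f by (rule continuous_map_image_closure_subset)
  also have "\<dots> \<subseteq> Y closure_of {w s z |s. \<bar>s\<bar> > n}"
    using m by (intro closure_of_mono) auto
  finally show "f y \<in> Y closure_of {w s z |s. \<bar>s\<bar> > n}" .
qed

lemma two_sided_limit_invariant:
  assumes "flow X v" "x \<in> topspace X" "y \<in> two_sided_limit X v x"
  shows "v t y \<in> two_sided_limit X v x"
proof (rule two_sided_limit_image[where f = "v t" and w = v and z = x, OF flow_continuous_time_map[OF assms(1)] _ assms(3)])
  fix n
  show "\<exists>m. \<forall>s. \<bar>s\<bar> > m \<longrightarrow> (\<exists>s'. \<bar>s'\<bar> > n \<and> v t (v s x) = v s' x)"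
  proof (rule exI[of _ "n + \<bar>t\<bar>"], intro allI impI)
    fix s :: real assume "\<bar>s\<bar> > n + \<bar>t\<bar>"
    then show "\<exists>s'. \<bar>s'\<bar> > n \<and> v t (v s x) = v s' x"
      using flow_add[OF assms(1,2), of t s] by (intro exI[of _ "t + s"]) auto
  qed
qed

section \<open>Hamiltonian vector fields\<close>

context
  fixes X :: "'b topology" and c :: "'b chart"
  assumes chart: "chart X c"
begin

lemma chart_dom_subset: "chart_dom c \<subseteq> topspace X"
  using chart openin_subset unfolding chart_def by blast

lemma coord_continuous: "continuous_map (subtopology X (chart_dom c)) (top_of_set (chart_img c)) (coord c)"
  using chart homeomorphic_imp_continuous_map unfolding chart_def by blast

lemma coord_inj: "inj_on (coord c) (chart_dom c)"
proof -
  have "inj_on (coord c) (topspace (subtopology X (chart_dom c)))"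
    using chart homeomorphic_imp_injective_map unfolding chart_def by blast
  then show ?thesis using chart_dom_subset by (simp add: Int_absorb1)
qed

lemma param_coord: "p \<in> chart_dom c \<Longrightarrow> param c (coord c p) = p"
  unfolding param_def using coord_inj by simp

lemma coord_in_img: "p \<in> chart_dom c \<Longrightarrow> coord c p \<in> chart_img c"
  unfolding chart_img_def by blast

lemma open_coord_preimage:
  assumes "open B"
  shows "openin X {p \<in> chart_dom c. coord c p \<in> B}"
proof -
  have "openin (top_of_set (chart_img c)) (chart_img c \<inter> B)" using assms by blast
  from openin_continuous_map_preimage[OF coord_continuous this]
  have "openin (subtopology X (chart_dom c))
    {p \<in> topspace (subtopology X (chart_dom c)). coord c p \<in> chart_img c \<inter> B}" .
  also have "{p \<in> topspace (subtopology X (chart_dom c)). coord c p \<in> chart_img c \<inter> B}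
      = {p \<in> chart_dom c. coord c p \<in> B}"
    using chart_dom_subset coord_in_img by auto
  finally show ?thesis using chart openin_trans_full unfolding chart_def by blast
qed

end

lemma Cr_on_imp_continuous_on:
  assumes "Cr_on r f A"
  shows "continuous_on A f"
  unfolding continuous_on_eq_continuous_within
proof
  fix x assume x: "x \<in> A"
  have "enat 0 \<le> r" by (simp add: enat_0)
  then obtain W g where W: "open W" "x \<in> W" "Ck_open 0 g W" "\<forall>y\<in>A \<inter> W. g y = f y"
    using assms x unfolding Cr_on_def by meson
  have "continuous (at x within A) g"
    using W by (auto simp: continuous_on_eq_continuous_at continuous_at_imp_continuous_at_within)
  moreover have "\<forall>\<^sub>F y in at x within A. g y = f y"
    using W(1,2,4) unfolding eventually_at_topological by blast
  moreover have "g x = f x" using x W by auto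
  ultimately show "continuous (at x within A) f"
    unfolding continuous_within by (metis (mono_tags, lifting) Lim_transform_eventually)
qed

lemma convex_half_plane: "convex half_plane"
  unfolding half_plane_def convex_def by simp

locale hamiltonian_system =
  fixes X :: "'b topology" and \<A> :: "'b chart set" and r :: nat
    and Y :: "'b chart \<Rightarrow> 'b \<Rightarrow> real ^ 2"
    and \<Omega> :: "'b chart \<Rightarrow> 'b \<Rightarrow> real ^ 2 \<Rightarrow> real ^ 2 \<Rightarrow> real"
    and H :: "'b \<Rightarrow> real" and w :: "real \<Rightarrow> 'b \<Rightarrow> 'b"
  assumes atlas: "smooth_atlas X \<A>"
    and field: "Cr_vector_field (enat r) \<A> Y"
    and volume: "volume_form \<A> \<Omega>"
    and hamilton: "\<And>c p. c \<in> \<A> \<Longrightarrow> p \<in> chart_dom c \<Longrightarrow>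
        ((H \<circ> param c) has_derivative \<Omega> c p (Y c p)) (at (coord c p) within chart_img c)"
    and flow: "flow X w"
    and generates: "generates X \<A> Y w"
begin

lemma chart_in_atlas: "c \<in> \<A> \<Longrightarrow> chart X c"
  using atlas unfolding smooth_atlas_def by blast

lemma chart_at:
  assumes "p \<in> topspace X"
  obtains c where "c \<in> \<A>" "p \<in> chart_dom c"
  using atlas assms unfolding smooth_atlas_def by blast

lemma stays_in_chart:
  assumes "p \<in> topspace X" "c \<in> \<A>" "w t p \<in> chart_dom c"
  obtains \<delta> where "\<delta> > 0" "\<And>s. \<bar>s - t\<bar> < \<delta> \<Longrightarrow> w s p \<in> chart_dom c"
proof -
  have "openin X (chart_dom c)" using chart_in_atlas[OF assms(2)] unfolding chart_def by blast
  from openin_continuous_map_preimage[OF flow_continuous_orbit[OF flow assms(1)] this]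
  have "open {s. w s p \<in> chart_dom c}" by simp
  then show thesis using assms(3) that unfolding open_dist dist_real_def by blast
qed

lemma coord_orbit_derivative:
  assumes "p \<in> topspace X" "c \<in> \<A>" "w t p \<in> chart_dom c"
  shows "((\<lambda>s. coord c (w s p)) has_vector_derivative Y c (w t p)) (at t)"
  using generates assms unfolding generates_def by blast

text \<open>The derivative of \<open>H\<close> along an orbit is \<open>\<Omega>(Y, Y)\<close>, and \<open>\<Omega>\<close> is alternating.\<close>

lemma hamiltonian_constant_on_orbits:
  assumes p: "p \<in> topspace X"
  shows "H (w t p) = H p"
proof -
  have "((\<lambda>s. H (w s p)) has_real_derivative 0) (at t)" for t
  proof -
    obtain c where c: "c \<in> \<A>" "w t p \<in> chart_dom c"
      using chart_at flow_in_space[OF flow p] by metis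
    note ch = chart_in_atlas[OF c(1)]
    obtain \<delta> where \<delta>: "\<delta> > 0" "\<And>s. \<bar>s - t\<bar> < \<delta> \<Longrightarrow> w s p \<in> chart_dom c"
      using stays_in_chart[OF p c] by blast
    define I where "I = ball t \<delta>"
    have I: "open I" "t \<in> I" "\<And>s. s \<in> I \<Longrightarrow> w s p \<in> chart_dom c"
      using \<delta> by (auto simp: I_def dist_real_def abs_minus_commute)
    define q where "q = w t p"
    have img: "(\<lambda>s. coord c (w s p)) ` I \<subseteq> chart_img c"
      using I(3) coord_in_img[OF ch] by auto
    have dH: "((H \<circ> param c) has_derivative \<Omega> c q (Y c q))
        (at (coord c (w t p)) within (\<lambda>s. coord c (w s p)) ` I)"
      using has_derivative_subset[OF hamilton[OF c] img] unfolding q_def .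
    have dc: "((\<lambda>s. coord c (w s p)) has_derivative (\<lambda>h. h *\<^sub>R Y c q)) (at t within I)"
      using coord_orbit_derivative[OF p c] has_derivative_at_withinI
      unfolding has_vector_derivative_def q_def by blast
    have comp: "((\<lambda>s. (H \<circ> param c) (coord c (w s p))) has_derivative
        (\<lambda>h. \<Omega> c q (Y c q) (h *\<^sub>R Y c q))) (at t within I)"
      using has_derivative_in_compose[OF dc dH] .
    have "bilinear (\<Omega> c q)" "\<Omega> c q (Y c q) (Y c q) = 0"
      using volume c unfolding volume_form_def q_def by blast+
    then have zero: "(\<lambda>h. \<Omega> c q (Y c q) (h *\<^sub>R Y c q)) = (\<lambda>h. 0)"
      by (simp add: bilinear_rmul)
    have "((\<lambda>s. (H \<circ> param c) (coord c (w s p))) has_derivative (\<lambda>h. 0)) (at t)"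
      using comp unfolding zero at_within_open[OF I(2,1)] .
    then have "((\<lambda>s. H (w s p)) has_derivative (\<lambda>h. 0)) (at t)"
      by (rule has_derivative_transform_within_open[OF _ I(1,2)])
        (simp add: param_coord[OF ch] I(3))
    then show ?thesis by (simp add: has_field_derivative_def lambda_zero)
  qed
  then have "H (w t p) = H (w 0 p)"
    by (intro DERIV_isconst_all[where f = "\<lambda>s. H (w s p)"]) blast
  then show ?thesis using flow_0[OF flow p] by simp
qed

lemma hamiltonian_continuous: "continuous_map X euclideanreal H"
proof (rule pasting_lemma[where I = \<A> and T = chart_dom and f = "\<lambda>_. H"])
  fix c assume c: "c \<in> \<A>"
  note ch = chart_in_atlas[OF c]
  show "openin X (chart_dom c)" using ch unfolding chart_def by blast
  have "continuous_on (chart_img c) (H \<circ> param c)"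
    unfolding continuous_on_eq_continuous_within
    using hamilton[OF c] has_derivative_continuous unfolding chart_img_def by blast
  then have "continuous_map (top_of_set (chart_img c)) euclideanreal (H \<circ> param c)" by simp
  from continuous_map_compose[OF coord_continuous[OF ch] this]
  show "continuous_map (subtopology X (chart_dom c)) euclideanreal H"
    by (rule continuous_map_eq) (use chart_dom_subset[OF ch] param_coord[OF ch] in auto)
qed (use chart_at in auto, blast)

lemma hamiltonian_constant_on_limit:
  assumes x: "x \<in> topspace X" and y: "y \<in> two_sided_limit X w x"
  shows "H y = H x"
proof -
  have "closedin X {z \<in> topspace X. H z \<in> {H x}}"
    by (rule closedin_continuous_map_preimage[OF hamiltonian_continuous]) simp
  moreover have "{w t x |t. \<bar>t\<bar> > 0} \<subseteq> {z \<in> topspace X. H z \<in> {H x}}"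
    using flow_in_space[OF flow x] hamiltonian_constant_on_orbits[OF x] by auto
  ultimately have "X closure_of {w t x |t. \<bar>t\<bar> > 0} \<subseteq> {z \<in> topspace X. H z \<in> {H x}}"
    by (rule closure_of_minimal[rotated])
  then show ?thesis using y unfolding two_sided_limit_def by blast
qed

text \<open>A nonsingular orbit can pass through zeros of \<open>Y\<close> when \<open>Y\<close> is only continuous: the curve
  \<open>t\<^sup>3\<close> solves \<open>x' = 3 \<bar>x\<bar>\<^bsup>2/3\<^esup>\<close>. But a coordinate curve with zero velocity throughout is locally
  constant.\<close>

lemma field_nonzero_on_orbit:
  assumes p: "p \<in> topspace X" "\<not> singular_point w p"
  obtains t c where "c \<in> \<A>" "w t p \<in> chart_dom c" "Y c (w t p) \<noteq> 0"
proof (rule ccontr)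
  assume "\<not> thesis"
  then have zero: "Y c (w t p) = 0" if "c \<in> \<A>" "w t p \<in> chart_dom c" for c t
    using that \<open>\<And>c t. \<lbrakk>c \<in> \<A>; w t p \<in> chart_dom c; Y c (w t p) \<noteq> 0\<rbrakk> \<Longrightarrow> thesis\<close> by blast
  have w0: "w 0 p = p" using flow_0[OF flow p(1)] .
  obtain c where c: "c \<in> \<A>" "w 0 p \<in> chart_dom c" using chart_at p(1) w0 by metis
  obtain \<delta> where \<delta>: "\<delta> > 0" "\<And>s. \<bar>s - 0\<bar> < \<delta> \<Longrightarrow> w s p \<in> chart_dom c"
    using stays_in_chart[OF p(1) c] by blast
  have "w s p = p" if s: "\<bar>s\<bar> < \<delta>" for s
  proof -
    have "coord c (w s p) = coord c (w 0 p)"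
    proof (rule has_derivative_zero_unique[where f = "\<lambda>s. coord c (w s p)" and s = "ball 0 \<delta>"])
      fix t :: real assume "t \<in> ball 0 \<delta>"
      then have t: "w t p \<in> chart_dom c" using \<delta> by auto
      show "((\<lambda>s. coord c (w s p)) has_derivative (\<lambda>h. 0)) (at t within ball 0 \<delta>)"
        using coord_orbit_derivative[OF p(1) c(1) t] zero[OF c(1) t] has_derivative_at_withinI
        unfolding has_vector_derivative_def by fastforce
    qed (use s \<delta> in auto)
    then show ?thesis
      using inj_onD[OF coord_inj[OF chart_in_atlas[OF c(1)]]] \<delta>(2) s c(2) w0 by simp
  qed
  then have "singular_point w p" using singular_if_locally_fixed[OF flow p(1) \<delta>(1)] by blast
  then show False using p(2) by blast
qed

text \<open>With \<open>u = Y c y\<close> and \<open>n\<close> the vector \<open>u\<close> turned by a right angle, \<open>dH(n) = \<Omega>(u, n)\<close> at \<open>y\<close> is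
  \<open>\<bar>u\<bar>\<^sup>2\<close> times the nonzero coefficient of the area form, so the orbit of \<open>y\<close> satisfies the
  hypotheses of \<open>level_set_covered_by_curve\<close> in the chart.\<close>

lemma level_set_is_local_orbit:
  assumes y: "c \<in> \<A>" "y \<in> chart_dom c" "Y c y \<noteq> 0"
  obtains U where "openin X U" "y \<in> U" "\<And>z. z \<in> U \<Longrightarrow> H z = H y \<Longrightarrow> \<exists>s. \<bar>s\<bar> < 1 \<and> z = w s y"
proof -
  note ch = chart_in_atlas[OF y(1)]
  have yX: "y \<in> topspace X" using chart_dom_subset[OF ch] y(2) by blast
  have w0: "w 0 y = y" using flow_0[OF flow yX] .
  define \<gamma> where "\<gamma> = (\<lambda>s. coord c (w s y))"
  define u where "u = Y c y"
  define n :: "real ^ 2" where "n = vector [- (u $ 2), u $ 1]"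
  define D where "D = (\<lambda>q. \<Omega> c (param c q) (Y c (param c q)))"
  have \<gamma>0: "\<gamma> 0 = coord c y" by (simp add: \<gamma>_def w0)
  obtain \<delta>' where \<delta>': "\<delta>' > 0" "\<And>s. \<bar>s - 0\<bar> < \<delta>' \<Longrightarrow> w s y \<in> chart_dom c"
    using stays_in_chart[OF yX y(1), of 0] y(2) w0 by auto
  define \<delta> where "\<delta> = min \<delta>' 1"
  have \<delta>: "\<delta> > 0" "\<delta> \<le> 1" "\<And>s. \<bar>s\<bar> < \<delta> \<Longrightarrow> w s y \<in> chart_dom c"
    using \<delta>' by (auto simp: \<delta>_def)
  have bil: "bilinear (\<Omega> c p)" and alt: "\<Omega> c p a a = 0"
    and ndeg: "\<exists>a b. \<Omega> c p a b \<noteq> 0" if "p \<in> chart_dom c" for p a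
    using volume y(1) that unfolding volume_form_def by blast+
  define \<kappa> where "\<kappa> = (\<lambda>p. \<Omega> c p (axis 1 1) (axis 2 1))"
  have det: "\<Omega> c p a b = (a $ 1 * b $ 2 - a $ 2 * b $ 1) * \<kappa> p" if "p \<in> chart_dom c" for p a b
    unfolding \<kappa>_def using alternating_bilinear_plane[OF bil[OF that] alt[OF that]] .
  have param_dom: "param c q \<in> chart_dom c" if "q \<in> chart_img c" for q
    using that param_coord[OF ch] unfolding chart_img_def by auto
  obtain \<epsilon> where \<epsilon>: "\<epsilon> > 0"
    "\<And>z. z \<in> chart_img c \<Longrightarrow> dist z (\<gamma> 0) < \<epsilon> \<Longrightarrow> (H \<circ> param c) z = (H \<circ> param c) (\<gamma> 0)
       \<Longrightarrow> \<exists>s. \<bar>s\<bar> < \<delta> \<and> z = \<gamma> s"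
  proof (rule level_set_covered_by_curve[OF convex_half_plane, where A = "chart_img c"
        and F = "H \<circ> param c" and D = D and u = u and \<gamma> = \<gamma> and \<delta> = \<delta>])
    show "openin (top_of_set half_plane) (chart_img c)" using ch unfolding chart_def by blast
    show "((H \<circ> param c) has_derivative D q) (at q within chart_img c)" if "q \<in> chart_img c" for q
      using that hamilton[OF y(1)] param_coord[OF ch] unfolding D_def chart_img_def by auto
    have "continuous_on (chart_img c) (\<lambda>q. Y c (param c q))"
      using field y(1) Cr_on_imp_continuous_on[of r "Y c \<circ> param c"]
      unfolding Cr_vector_field_def o_def by blast
    moreover have "continuous_on (chart_img c) (\<lambda>q. \<kappa> (param c q))"
      using volume y(1) Cr_on_imp_continuous_on unfolding volume_form_def \<kappa>_def by blast
    ultimately have "continuous_on (chart_img c)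
        (\<lambda>q. (Y c (param c q) $ 1 * n $ 2 - Y c (param c q) $ 2 * n $ 1) * \<kappa> (param c q))"
      by (intro continuous_intros)
    then show "continuous_on (chart_img c) (\<lambda>q. D q (vector [- (u $ 2), u $ 1]))"
      unfolding n_def[symmetric] D_def
      by (rule continuous_on_eq) (simp add: det param_dom)
    show "D (\<gamma> 0) (vector [- (u $ 2), u $ 1]) \<noteq> 0"
    proof -
      have "\<kappa> y \<noteq> 0" using ndeg[OF y(2)] det[OF y(2)] by auto
      moreover have "u $ 1 * u $ 1 + u $ 2 * u $ 2 \<noteq> 0"
        using y(3) unfolding u_def[symmetric]
        by (auto simp: vec_eq_iff forall_2 sum_squares_eq_zero_iff)
      moreover have "D (\<gamma> 0) n = (u $ 1 * u $ 1 + u $ 2 * u $ 2) * \<kappa> y"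
        unfolding D_def \<gamma>0 param_coord[OF ch y(2)] u_def[symmetric]
        by (simp add: det[OF y(2)] n_def)
      ultimately show ?thesis unfolding n_def by simp
    qed
    show "u \<noteq> 0" using y(3) by (simp add: u_def)
    show "(\<gamma> has_vector_derivative u) (at 0)"
      using coord_orbit_derivative[OF yX y(1), of 0] y(2) w0 unfolding \<gamma>_def u_def by simp
    show "continuous_on {-\<delta><..<\<delta>} \<gamma>"
      unfolding continuous_on_eq_continuous_within \<gamma>_def
    proof
      fix s assume "s \<in> {-\<delta><..<\<delta>}"
      then have "w s y \<in> chart_dom c" using \<delta>(3) by auto
      from has_vector_derivative_continuous[OF coord_orbit_derivative[OF yX y(1) this]]
      show "continuous (at s within {-\<delta><..<\<delta>}) (\<lambda>s. coord c (w s y))"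
        by (rule continuous_at_imp_continuous_at_within)
    qed
    show "\<gamma> s \<in> chart_img c" if "\<bar>s\<bar> < \<delta>" for s
      using coord_in_img[OF ch \<delta>(3)[OF that]] by (simp add: \<gamma>_def)
    show "(H \<circ> param c) (\<gamma> s) = (H \<circ> param c) (\<gamma> 0)" if "\<bar>s\<bar> < \<delta>" for s
      using hamiltonian_constant_on_orbits[OF yX, of s] param_coord[OF ch \<delta>(3)[OF that]]
        param_coord[OF ch y(2)]
      by (simp add: \<gamma>_def w0)
  qed (use \<delta> in auto)
  show thesis
  proof (rule that)
    show "openin X {p \<in> chart_dom c. coord c p \<in> ball (coord c y) \<epsilon>}"
      by (rule open_coord_preimage[OF ch]) simp
    show "y \<in> {p \<in> chart_dom c. coord c p \<in> ball (coord c y) \<epsilon>}" using y(2) \<epsilon>(1) by simp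
    fix z assume z: "z \<in> {p \<in> chart_dom c. coord c p \<in> ball (coord c y) \<epsilon>}" "H z = H y"
    then obtain s where s: "\<bar>s\<bar> < \<delta>" "coord c z = \<gamma> s"
      using \<epsilon>(2)[of "coord c z"] coord_in_img[OF ch] param_coord[OF ch] y(2)
      unfolding \<gamma>0 by (auto simp: dist_commute)
    have "z = w s y"
      using inj_onD[OF coord_inj[OF ch]] s(2) z(1) \<delta>(3)[OF s(1)] unfolding \<gamma>_def by blast
    then show "\<exists>s. \<bar>s\<bar> < 1 \<and> z = w s y" using s(1) \<delta>(2) by (intro exI[of _ s]) auto
  qed
qed

text \<open>The orbit of \<open>x\<close> meets the piece \<open>\<bar>s\<bar> < 1\<close> of the orbit of \<open>z\<close> at two times \<open>T\<^sub>1\<close> and \<open>T\<^sub>2\<close>. If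
  these correspond to the parameters \<open>s\<^sub>1\<close> and \<open>s\<^sub>2\<close>, then \<open>(T\<^sub>2 - s\<^sub>2) - (T\<^sub>1 - s\<^sub>1)\<close> is a period. It is
  nonzero when the two times are more than \<open>2\<close> apart.\<close>

lemma closed_if_nonsingular_limit_point:
  assumes "Hausdorff_space X" and x: "x \<in> topspace X"
    and y: "y \<in> two_sided_limit X w x" "\<not> singular_point w y"
  shows "closed_point w x"
proof -
  have "y \<in> topspace X" using y(1) two_sided_limit_in_space by fast
  then obtain t c where c: "c \<in> \<A>" "w t y \<in> chart_dom c" "Y c (w t y) \<noteq> 0"
    using field_nonzero_on_orbit y(2) by blast
  define z where "z = w t y"
  have z: "z \<in> two_sided_limit X w x"
    unfolding z_def by (rule two_sided_limit_invariant[OF flow x y(1)])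
  obtain U where U: "openin X U" "z \<in> U" "\<And>z'. z' \<in> U \<Longrightarrow> H z' = H z \<Longrightarrow> \<exists>s. \<bar>s\<bar> < 1 \<and> z' = w s z"
    using level_set_is_local_orbit[OF c] unfolding z_def by blast
  have zX: "z \<in> topspace X" using z two_sided_limit_in_space by fast
  have return: "\<exists>T s. \<bar>T\<bar> > n \<and> \<bar>s\<bar> < 1 \<and> w T x = w s z" for n
  proof -
    have "z \<in> X closure_of {w T x |T. \<bar>T\<bar> > n}" using z unfolding two_sided_limit_def by blast
    then obtain T where T: "\<bar>T\<bar> > n" "w T x \<in> U" using U(1,2) unfolding in_closure_of by blast
    have "H (w T x) = H z"
      using hamiltonian_constant_on_limit[OF x z] hamiltonian_constant_on_orbits[OF x] by simp
    then show ?thesis using U(3) T by blast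
  qed
  obtain T\<^sub>1 s\<^sub>1 where 1: "\<bar>s\<^sub>1\<bar> < 1" "w T\<^sub>1 x = w s\<^sub>1 z" using return[of 0] by blast
  obtain T\<^sub>2 s\<^sub>2 where 2: "\<bar>T\<^sub>2\<bar> > \<bar>T\<^sub>1\<bar> + 2" "\<bar>s\<^sub>2\<bar> < 1" "w T\<^sub>2 x = w s\<^sub>2 z" using return by blast
  have "w (T\<^sub>2 + s\<^sub>1) x = w (s\<^sub>1 + s\<^sub>2) z"
    using flow_add[OF flow x, of s\<^sub>1 T\<^sub>2] flow_add[OF flow zX, of s\<^sub>1 s\<^sub>2] 2(3)
    by (simp add: add.commute)
  also have "\<dots> = w (T\<^sub>1 + s\<^sub>2) x"
    using flow_add[OF flow x, of s\<^sub>2 T\<^sub>1] flow_add[OF flow zX, of s\<^sub>2 s\<^sub>1] 1(2)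
    by (simp add: add.commute)
  finally have "w ((T\<^sub>2 + s\<^sub>1) - (T\<^sub>1 + s\<^sub>2)) x = x" using flow_period_iff[OF flow x] by blast
  moreover have "(T\<^sub>2 + s\<^sub>1) - (T\<^sub>1 + s\<^sub>2) \<noteq> 0" using 1(1) 2(1,2) by linarith
  ultimately show ?thesis by (rule closed_point_if_period[OF flow assms(1) x])
qed

end

section \<open>Transfer along a topological equivalence\<close>

text \<open>The reparametrization of time along an orbit preserves \<open>\<bar>t\<bar> \<rightarrow> \<infinity>\<close>.\<close>

lemma increasing_homeomorphism_unbounded:
  fixes \<tau> :: "real \<Rightarrow> real"
  assumes "strict_mono \<tau>" "surj \<tau>"
  shows "\<exists>m. \<forall>t. \<bar>t\<bar> > m \<longrightarrow> \<bar>\<tau> t\<bar> > n"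
proof -
  obtain a b where ab: "\<tau> a = - \<bar>n\<bar>" "\<tau> b = \<bar>n\<bar>" using assms(2) by (metis surjD)
  show ?thesis
  proof (intro exI[of _ "max \<bar>a\<bar> \<bar>b\<bar>"] allI impI)
    fix t assume t: "\<bar>t\<bar> > max \<bar>a\<bar> \<bar>b\<bar>"
    show "\<bar>\<tau> t\<bar> > n"
    proof (cases "t > 0")
      case True
      then have "\<tau> b < \<tau> t" using t assms(1) by (intro strict_monoD[of \<tau>]) auto
      then show ?thesis using ab by auto
    next
      case False
      then have "\<tau> t < \<tau> a" using t assms(1) by (intro strict_monoD[of \<tau>]) auto
      then show ?thesis using ab by auto
    qed
  qed
qed

lemma hamiltonian_flow_limit_singular:
  fixes S :: "'a topology" and v :: "real \<Rightarrow> 'a \<Rightarrow> 'a"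
  assumes "Hausdorff_space S" and ham: "hamiltonian_flow TYPE('b) S v"
    and x: "x \<in> topspace S" "\<not> closed_point v x"
    and y: "y \<in> two_sided_limit S v x"
  shows "singular_point v y"
proof -
  obtain \<Sigma> :: "'b topology" and \<A> r Y w where
    \<Sigma>: "surface \<Sigma>" "smooth_atlas \<Sigma> \<A>" "hamiltonian_vector_field r \<A> Y" "flow \<Sigma> w"
      "generates \<Sigma> \<A> Y w" "topologically_equivalent S v \<Sigma> w" and v: "flow S v"
    using ham unfolding hamiltonian_flow_def by blast
  obtain \<Omega> H where "hamiltonian_system \<Sigma> \<A> r Y \<Omega> H w"
    using \<Sigma> unfolding hamiltonian_vector_field_def hamiltonian_system_def by blast
  then interpret hamiltonian_system \<Sigma> \<A> r Y \<Omega> H w .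
  have Haus: "Hausdorff_space \<Sigma>" using \<Sigma>(1) unfolding surface_def by blast
  obtain h where h: "homeomorphic_map S \<Sigma> h"
    and time: "\<And>p. p \<in> topspace S \<Longrightarrow> \<exists>\<tau>. homeomorphic_map euclideanreal euclideanreal \<tau> \<and>
        strict_mono \<tau> \<and> (\<forall>t. h (v t p) = w (\<tau> t) (h p))"
    using \<Sigma>(6) unfolding topologically_equivalent_def by blast
  have cont: "continuous_map S \<Sigma> h" and inj: "inj_on h (topspace S)"
    using h homeomorphic_imp_continuous_map homeomorphic_imp_injective_map by blast+
  have hX: "h p \<in> topspace \<Sigma>" if "p \<in> topspace S" for p
    using cont that by (auto simp: continuous_map_def)
  have yS: "y \<in> topspace S" using y two_sided_limit_in_space by fast
  obtain \<tau> where \<tau>: "strict_mono \<tau>" "\<And>t. h (v t x) = w (\<tau> t) (h x)" and "surj \<tau>"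
    using time[OF x(1)] homeomorphic_imp_surjective_map by fastforce
  have "h y \<in> two_sided_limit \<Sigma> w (h x)"
  proof (rule two_sided_limit_image[OF cont _ y])
    show "\<exists>m. \<forall>t. \<bar>t\<bar> > m \<longrightarrow> (\<exists>s. \<bar>s\<bar> > n \<and> h (v t x) = w s (h x))" for n
      using increasing_homeomorphism_unbounded[OF \<tau>(1) \<open>surj \<tau>\<close>, of n] \<tau>(2) by blast
  qed
  moreover have "\<not> closed_point w (h x)"
  proof
    assume "closed_point w (h x)"
    then obtain T where T: "T > 0" "w T (h x) = h x"
      unfolding closed_point_def singular_point_def periodic_point_def
      by (metis zero_less_one)
    \<comment> \<open>The reparametrization need not fix \<open>0\<close>, so the period is added to \<open>\<tau> 0\<close>.\<close>
    obtain t where t: "\<tau> t = T + \<tau> 0" using \<open>surj \<tau>\<close> by (metis surjD)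
    have "h (v t x) = w T (h (v 0 x))"
      using \<tau>(2) t flow_add[OF flow hX[OF x(1)], of T "\<tau> 0"] by simp
    then have "h (v t x) = h x" using T(2) flow_0[OF v x(1)] by simp
    then have "v t x = x" using inj_onD[OF inj] flow_in_space[OF v x(1)] x(1) by blast
    moreover have "t \<noteq> 0" using t T(1) by auto
    ultimately show False using closed_point_if_period[OF v assms(1) x(1)] x(2) by blast
  qed
  ultimately have sing: "singular_point w (h y)"
    using closed_if_nonsingular_limit_point[OF Haus hX[OF x(1)]] by blast
  show ?thesis
    unfolding singular_point_def
  proof
    fix t
    have "h (v t y) = h y" using time[OF yS] sing unfolding singular_point_def by metis
    then show "v t y = y" using inj_onD[OF inj] flow_in_space[OF v yS] yS by blast
  qed
qed

theorem theorem3: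
  fixes S :: "'a topology" and v :: "real \<Rightarrow> 'a \<Rightarrow> 'a"
  assumes "surface S"
    and "hamiltonian_flow TYPE('b) S v"
  shows "(\<forall>x\<in>topspace S. \<not> closed_point v x \<longrightarrow>
            (\<forall>y\<in>omega_limit S v x. singular_point v y)) \<and>
         \<not> (\<exists>x\<in>topspace S. \<not> closed_point v x \<and> recurrent_point S v x)"
proof -
  have "Hausdorff_space S" using assms(1) unfolding surface_def by blast
  then have sing: "singular_point v y"
    if "x \<in> topspace S" "\<not> closed_point v x" "y \<in> omega_limit S v x \<union> alpha_limit S v x" for x y
    using hamiltonian_flow_limit_singular[OF _ assms(2)] that omega_alpha_subset_two_sided_limit
    by fast
  show ?thesis
    using sing unfolding recurrent_point_def closed_point_def by blast
qed

end
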